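(* Let $n\geq 1$ and $v\geq 2$ be integers. Then the kernel scheme $\overrightarrow{k(n,v)}$ is the $n$-th wreath power of the class-one association scheme of size $v$: $$\overrightarrow{k(n,v)}=H(1,v)^{\leftthreetimes n}.$$ (The equality is as association schemes: taking the same set $V$ of cardinality $v$ as underlying set of $H(1,v)$ and as alphabet, both schemes have underlying set $V^n$ and they coincide up to the evident bijective renaming of the relations.)
   Context: Association scheme: a triple $(X,R,I)$ with $X,I$ finite sets and $R:X\times X\to I$ a surjection. For $i\in I$ let $A_i$ be the $0/1$ matrix indexed by $X\times X$ with entry $1$ exactly on $R^{-1}(i)$, and let $A_X$ be the complex linear span of the $A_i$. The requirements are: (1) there is $i_0\in I$ with $A_{i_0}$ the identity matrix; (2) $A_X$ is closed under matrix product; (3) $A_X$ is closed under transpose. The symbol $i_0$ is used for the identity relation of every scheme. Wreath product of schemes $(X,R_X,I_X)$ and $(Y,R_Y,I_Y)$: the scheme $X\leftthreetimes Y$ with underlying set $X\times Y$, relation set $I_X\leftthreetimes I_Y:=(I_X\setminus\{i_0\})\coprod I_Y$, and $R_{\leftthreetimes}((x,y),(x',y'))=R_X(x,x')\in I_X\setminus\{i_0\}$ if $x\neq x'$, and $=R_Y(y,y')\in I_Y$ if $x=x'$. Wreath powers: $X^{\leftthreetimes 1}:=X$ and $X^{\leftthreetimes n}:=(X^{\leftthreetimes (n-1)})\leftthreetimes X$ for $n\geq2$. $H(1,v)$: the association scheme with underlying set of cardinality $v$ and $I=\{i_0,i_1\}$, where $R(x,y)=i_0$ if $x=y$ and $R(x,y)=i_1$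 otherwise. Kernel scheme $\overrightarrow{k(n,v)}$: let $V$ be a finite set with $\#V=v$, $X_n=V^n$, $I_n=\{1,2,\dots,n\}\cup\{\infty\}$, and for $x=(x_1,\dots,x_n)$, $y=(y_1,\dots,y_n)$ in $X_n$ let $R_n(x,y)$ be the smallest index $i$ with $x_i\neq y_i$, and $R_n(x,y)=\infty$ if $x=y$. The kernel scheme is $(X_n,R_n,I_n)$, with $\infty$ its identity relation. *)

theory Defs
  imports Complex_Main "HOL-Library.Extended_Nat"
begin

text \<open>Triples \<open>(X, R, I)\<close>. Only the values of \<^term>\<open>R\<close> on \<open>X \<times> X\<close> are meaningful.\<close>

record ('a, 'i) scheme =
  points :: "'a set"
  rel :: "'a \<Rightarrow> 'a \<Rightarrow> 'i"
  labels :: "'i set"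

text \<open>A matrix indexed by \<open>X \<times> X\<close> is a function of two arguments that vanishes outside \<open>X \<times> X\<close>.\<close>

definition adj_mat :: "('a, 'i) scheme \<Rightarrow> 'i \<Rightarrow> 'a \<Rightarrow> 'a \<Rightarrow> complex" where
  "adj_mat S i =
    (\<lambda>x y. if x \<in> points S \<and> y \<in> points S \<and> rel S x y = i then 1 else 0)"

definition id_mat :: "'a set \<Rightarrow> 'a \<Rightarrow> 'a \<Rightarrow> complex" where
  "id_mat X = (\<lambda>x y. if x \<in> X \<and> y \<in> X \<and> x = y then 1 else 0)"

definition mat_prod ::
    "'a set \<Rightarrow> ('a \<Rightarrow> 'a \<Rightarrow> complex) \<Rightarrow> ('a \<Rightarrow> 'a \<Rightarrow> complex) \<Rightarrow> 'a \<Rightarrow> 'a \<Rightarrow> complex" where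
  "mat_prod X M N = (\<lambda>x y. \<Sum>z\<in>X. M x z * N z y)"

definition mat_transpose :: "('a \<Rightarrow> 'a \<Rightarrow> complex) \<Rightarrow> 'a \<Rightarrow> 'a \<Rightarrow> complex" where
  "mat_transpose M = (\<lambda>x y. M y x)"

definition adj_span :: "('a, 'i) scheme \<Rightarrow> ('a \<Rightarrow> 'a \<Rightarrow> complex) set" where
  "adj_span S = {M. \<exists>c. M = (\<lambda>x y. \<Sum>i\<in>labels S. c i * adj_mat S i x y)}"

definition assoc_scheme :: "('a, 'i) scheme \<Rightarrow> bool" where
  "assoc_scheme S \<longleftrightarrow>
     finite (points S) \<and> finite (labels S) \<and>
     (\<lambda>(x, y). rel S x y) ` (points S \<times> points S) = labels S \<and>
     (\<exists>i\<in>labels S. adj_mat S i = id_mat (points S)) \<and>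
     (\<forall>M\<in>adj_span S. \<forall>N\<in>adj_span S. mat_prod (points S) M N \<in> adj_span S) \<and>
     (\<forall>M\<in>adj_span S. mat_transpose M \<in> adj_span S)"

text \<open>The identity relation \<open>i\<^sub>0\<close>. It is unique for an association scheme: surjectivity of
  \<open>R\<close> and \<open>i\<^sub>0 \<in> I\<close> force \<open>X\<close> to be nonempty.\<close>

definition id_label :: "('a, 'i) scheme \<Rightarrow> 'i" where
  "id_label S = (THE i. i \<in> labels S \<and> adj_mat S i = id_mat (points S))"

definition wreath :: "('a, 'i) scheme \<Rightarrow> ('b, 'j) scheme \<Rightarrow> ('a \<times> 'b, 'i + 'j) scheme" where
  "wreath S T =
    \<lparr>points = points S \<times> points T,
     rel = (\<lambda>(x, y) (x', y'). if x \<noteq> x' then Inl (rel S x x') else Inr (rel T y y')),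
     labels = (labels S - {id_label S}) <+> labels T\<rparr>"

text \<open>Renaming of points by \<open>f\<close> and of relations by \<open>g\<close>; meant for \<open>f\<close> injective on the
  points and \<open>g\<close> injective on the labels.\<close>

definition rename :: "('a \<Rightarrow> 'b) \<Rightarrow> ('i \<Rightarrow> 'j) \<Rightarrow> ('a, 'i) scheme \<Rightarrow> ('b, 'j) scheme" where
  "rename f g S =
    \<lparr>points = f ` points S,
     rel = (\<lambda>x y. g (rel S (inv_into (points S) f x) (inv_into (points S) f y))),
     labels = g ` labels S\<rparr>"

text \<open>Iterating \<^const>\<open>wreath\<close> changes the types of points and labels at each step. All
  powers are therefore realised in one type: \<open>X\<^sup>n\<^sup>-\<^sup>1 \<times> X\<close> is identified with \<open>X\<^sup>n\<close>
  (lists of length \<open>n\<close>) by appending the last coordinate, and the two summands of the label set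
  \<open>(I\<^sub>n\<^sub>-\<^sub>1 - {i\<^sub>0}) <+> I\<close> are embedded by the constructors \<open>Old\<close> and \<open>New\<close>.\<close>

datatype 'i power_label = New 'i | Old "'i power_label"

fun wreath_power :: "('a, 'i) scheme \<Rightarrow> nat \<Rightarrow> ('a list, 'i power_label) scheme" where
  "wreath_power S (Suc 0) = rename (\<lambda>x. [x]) New S"
| "wreath_power S (Suc (Suc n)) =
     rename (\<lambda>(xs, x). xs @ [x]) (case_sum Old New) (wreath (wreath_power S (Suc n)) S)"

datatype h_label = I0 | I1

definition H1 :: "'v set \<Rightarrow> ('v, h_label) scheme" where
  "H1 V = \<lparr>points = V, rel = (\<lambda>x y. if x = y then I0 else I1), labels = {I0, I1}\<rparr>"

text \<open>Indices of coordinates start at 1, list positions at 0.\<close>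

definition kernel_scheme :: "nat \<Rightarrow> 'v set \<Rightarrow> ('v list, enat) scheme" where
  "kernel_scheme n V =
    \<lparr>points = {xs. length xs = n \<and> set xs \<subseteq> V},
     rel = (\<lambda>x y. if x = y then \<infinity>
                  else enat (LEAST i. 1 \<le> i \<and> i \<le> n \<and> x ! (i - 1) \<noteq> y ! (i - 1))),
     labels = enat ` {1..n} \<union> {\<infinity>}\<rparr>"

text \<open>Equality of schemes up to a bijective renaming of the relations; the points are not
  renamed. For association schemes the renaming automatically matches the identity relations.\<close>

definition same_scheme :: "('a, 'i) scheme \<Rightarrow> ('a, 'j) scheme \<Rightarrow> bool" where
  "same_scheme S T \<longleftrightarrow>
     points S = points T \<and>
     (\<exists>\<phi>. bij_betw \<phi> (labels S) (labels T) \<and>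
          (\<forall>x\<in>points S. \<forall>y\<in>points S. rel T x y = \<phi> (rel S x y)))"

end

theory Submission
  imports Defs
begin

text \<open>
  Compare two words of length \<open>n + 1\<close>: if their prefixes of length \<open>n\<close> differ, the first
  differing position is that of the prefixes; otherwise only the last letter can differ. This is
  the case distinction that defines the relation of a wreath product with \<open>H(1,v)\<close>, so
  the two schemes agree by induction on the length. The only label whose meaning changes in the
  step is ``equal'': on prefixes it is dropped as the identity relation, and it is replaced by the
  two labels that say whether the last letters agree. Hence ``first difference at \<open>i\<close>''
  corresponds to \<open>New I1\<close> under \<open>n - i\<close> constructors \<open>Old\<close>, and
  equality always to \<open>New I0\<close> (lemmas \<open>kernel_scheme_snoc\<close> and
  \<open>wreath_power_H1\<close>).

  That these objects are association schemes follows from the general fact that the wreath product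
  of two association schemes is one (\<open>assoc_scheme_wreath\<close>). It is convenient to replace
  matrices by functions of labels: the span of the adjacency matrices consists of the matrices whose
  \<open>(x, y)\<close> entry depends only on \<open>R(x, y)\<close>, so closure under products says
  that convolution sums depend only on the relation of their endpoints. A convolution sum over
  \<open>X \<times> Y\<close> splits into the fibre over \<open>x\<close>, the fibre over
  \<open>x'\<close>, and the rest. The rest is \<open>|Y|\<close> times a convolution in
  \<open>X\<close>; the two fibres contribute row and column sums in \<open>Y\<close>, which are
  constant, or, when \<open>x = x'\<close> and they coincide, a convolution in \<open>Y\<close>.
\<close>

section \<open>Association schemes in terms of functions of labels\<close>

definition label_mat :: "('a, 'i) scheme \<Rightarrow> ('i \<Rightarrow> complex) \<Rightarrow> 'a \<Rightarrow> 'a \<Rightarrow> complex" where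
  "label_mat S c = (\<lambda>x y. if x \<in> points S \<and> y \<in> points S then c (rel S x y) else 0)"

lemma adj_span_eq_range_label_mat:
  assumes "finite (labels S)"
    and "\<And>x y. x \<in> points S \<Longrightarrow> y \<in> points S \<Longrightarrow> rel S x y \<in> labels S"
  shows "adj_span S = range (label_mat S)"
proof -
  have "(\<lambda>x y. \<Sum>i\<in>labels S. c i * adj_mat S i x y) = label_mat S c" for c
  proof (intro ext)
    fix x y
    show "(\<Sum>i\<in>labels S. c i * adj_mat S i x y) = label_mat S c x y"
    proof (cases "x \<in> points S \<and> y \<in> points S")
      case True
      then have "(\<Sum>i\<in>labels S. c i * adj_mat S i x y) =
          (\<Sum>i\<in>labels S. if rel S x y = i then c i else 0)"
        by (intro sum.cong) (auto simp: adj_mat_def)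
      also have "\<dots> = c (rel S x y)"
        using assms True by (simp add: sum.delta')
      finally show ?thesis using True by (simp add: label_mat_def)
    qed (auto simp: adj_mat_def label_mat_def)
  qed
  then show ?thesis by (auto simp: adj_span_def)
qed

lemma label_mat_eq_iff:
  "label_mat S f = label_mat S h \<longleftrightarrow>
     (\<forall>x\<in>points S. \<forall>y\<in>points S. f (rel S x y) = h (rel S x y))"
  unfolding label_mat_def fun_eq_iff by auto

lemma mat_prod_label_mat_eq_iff:
  "mat_prod (points S) (label_mat S f) (label_mat S g) = label_mat S h \<longleftrightarrow>
     (\<forall>x\<in>points S. \<forall>y\<in>points S.
        (\<Sum>z\<in>points S. f (rel S x z) * g (rel S z y)) = h (rel S x y))"
proof -
  have "mat_prod (points S) (label_mat S f) (label_mat S g) x y =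
      (if x \<in> points S \<and> y \<in> points S
       then \<Sum>z\<in>points S. f (rel S x z) * g (rel S z y) else 0)" for x y
    by (auto simp: mat_prod_def label_mat_def)
  then show ?thesis unfolding fun_eq_iff label_mat_def by auto
qed

lemma mat_transpose_label_mat_eq_iff:
  "mat_transpose (label_mat S f) = label_mat S h \<longleftrightarrow>
     (\<forall>x\<in>points S. \<forall>y\<in>points S. f (rel S y x) = h (rel S x y))"
  unfolding fun_eq_iff label_mat_def mat_transpose_def by auto

lemma adj_mat_eq_id_mat_iff:
  "adj_mat S i = id_mat (points S) \<longleftrightarrow>
     (\<forall>x\<in>points S. \<forall>y\<in>points S. rel S x y = i \<longleftrightarrow> x = y)"
  unfolding fun_eq_iff adj_mat_def id_mat_def by auto

text \<open>The pointwise form of the axioms: each matrix in the span is a function of the label, so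
  both closure properties become statements about which label functions are again functions
  of the label of \<open>(x, y)\<close>.\<close>

lemma assoc_scheme_iff:
  "assoc_scheme S \<longleftrightarrow>
     finite (points S) \<and> finite (labels S) \<and>
     (\<lambda>(x, y). rel S x y) ` (points S \<times> points S) = labels S \<and>
     (\<exists>i\<in>labels S. \<forall>x\<in>points S. \<forall>y\<in>points S. rel S x y = i \<longleftrightarrow> x = y) \<and>
     (\<forall>f g :: 'i \<Rightarrow> complex. \<exists>h. \<forall>x\<in>points S. \<forall>y\<in>points S.
        (\<Sum>z\<in>points S. f (rel S x z) * g (rel S z y)) = h (rel S x y)) \<and>
     (\<forall>f :: 'i \<Rightarrow> complex. \<exists>h. \<forall>x\<in>points S. \<forall>y\<in>points S.
        f (rel S y x) = h (rel S x y))" (is "_ \<longleftrightarrow> ?fp \<and> ?fl \<and> ?surj \<and> _")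
  for S :: "('a, 'i) scheme"
proof (cases "?fl \<and> ?surj")
  case True
  then have "adj_span S = range (label_mat S)"
    by (intro adj_span_eq_range_label_mat) auto
  then show ?thesis
    unfolding assoc_scheme_def
    by (simp add: image_iff mat_prod_label_mat_eq_iff mat_transpose_label_mat_eq_iff
        adj_mat_eq_id_mat_iff)
qed (auto simp: assoc_scheme_def)

lemma rel_in_labels:
  assumes "assoc_scheme S" "x \<in> points S" "y \<in> points S"
  shows "rel S x y \<in> labels S"
  using assms unfolding assoc_scheme_def by auto

lemma label_image:
  assumes "assoc_scheme S"
  shows "(\<lambda>(x, y). rel S x y) ` (points S \<times> points S) = labels S"
  using assms unfolding assoc_scheme_def by blast

lemma points_nonempty:
  assumes "assoc_scheme S"
  shows "points S \<noteq> {}"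
  using assms unfolding assoc_scheme_def by auto

lemma convolution_function:
  fixes f g :: "'i \<Rightarrow> complex" and S :: "('a, 'i) scheme"
  assumes "assoc_scheme S"
  obtains h where "\<And>x y. x \<in> points S \<Longrightarrow> y \<in> points S \<Longrightarrow>
    (\<Sum>z\<in>points S. f (rel S x z) * g (rel S z y)) = h (rel S x y)"
proof -
  have "\<forall>f g :: 'i \<Rightarrow> complex. \<exists>h. \<forall>x\<in>points S. \<forall>y\<in>points S.
      (\<Sum>z\<in>points S. f (rel S x z) * g (rel S z y)) = h (rel S x y)"
    using assms unfolding assoc_scheme_iff by (elim conjE)
  then show thesis using that by metis
qed

lemma transpose_function:
  fixes f :: "'i \<Rightarrow> complex" and S :: "('a, 'i) scheme"
  assumes "assoc_scheme S"
  obtains h where "\<And>x y. x \<in> points S \<Longrightarrow> y \<in> points S \<Longrightarrow> f (rel S y x) = h (rel S x y)"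
proof -
  have "\<forall>f :: 'i \<Rightarrow> complex. \<exists>h. \<forall>x\<in>points S. \<forall>y\<in>points S. f (rel S y x) = h (rel S x y)"
    using assms unfolding assoc_scheme_iff by (elim conjE)
  then show thesis using that by metis
qed

text \<open>Since there is a point, at most one label can be that of all diagonal pairs, so the
  definite description in \<^const>\<open>id_label\<close> picks the label provided by the axioms.\<close>

lemma id_label:
  assumes "assoc_scheme S"
  shows "id_label S \<in> labels S"
    and "\<And>x y. x \<in> points S \<Longrightarrow> y \<in> points S \<Longrightarrow> rel S x y = id_label S \<longleftrightarrow> x = y"
proof -
  have "\<exists>i\<in>labels S. \<forall>x\<in>points S. \<forall>y\<in>points S. rel S x y = i \<longleftrightarrow> x = y"
    using assms unfolding assoc_scheme_iff by (elim conjE)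
  then obtain i where i: "i \<in> labels S"
    "\<And>x y. x \<in> points S \<Longrightarrow> y \<in> points S \<Longrightarrow> rel S x y = i \<longleftrightarrow> x = y"
    by blast
  obtain p where p: "p \<in> points S" using points_nonempty[OF assms] by blast
  have "id_label S = i"
    unfolding id_label_def adj_mat_eq_id_mat_iff
  proof (rule the_equality)
    show "i \<in> labels S \<and> (\<forall>x\<in>points S. \<forall>y\<in>points S. rel S x y = i \<longleftrightarrow> x = y)"
      using i by blast
    show "j = i" if "j \<in> labels S \<and> (\<forall>x\<in>points S. \<forall>y\<in>points S. rel S x y = j \<longleftrightarrow> x = y)" for j
      using that p i(2)[OF p p] by metis
  qed
  with i show "id_label S \<in> labels S"
    and "\<And>x y. x \<in> points S \<Longrightarrow> y \<in> points S \<Longrightarrow> rel S x y = id_label S \<longleftrightarrow> x = y"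
    by auto
qed

section \<open>Isomorphic schemes\<close>

lemma assoc_scheme_isomorphic:
  fixes S :: "('a, 'i) scheme" and T :: "('b, 'j) scheme"
  assumes S: "assoc_scheme S"
    and f: "bij_betw f (points S) (points T)"
    and g: "bij_betw g (labels S) (labels T)"
    and rel: "\<And>x y. x \<in> points S \<Longrightarrow> y \<in> points S \<Longrightarrow> rel T (f x) (f y) = g (rel S x y)"
  shows "assoc_scheme T"
  unfolding assoc_scheme_iff
proof (intro conjI allI)
  have pts: "points T = f ` points S" and lbl: "labels T = g ` labels S"
    using f g by (auto simp: bij_betw_def)
  have inv: "inv_into (labels S) g (g (rel S x y)) = rel S x y"
    if "x \<in> points S" "y \<in> points S" for x y
    using g rel_in_labels[OF S that] by (simp add: bij_betw_def)
  show "finite (points T)" "finite (labels T)"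
    using S by (auto simp: pts lbl assoc_scheme_def)
  have "(\<lambda>(x, y). rel T x y) ` (points T \<times> points T) =
      g ` (\<lambda>(x, y). rel S x y) ` (points S \<times> points S)"
    using rel by (force simp: pts image_iff)
  then show "(\<lambda>(x, y). rel T x y) ` (points T \<times> points T) = labels T"
    by (simp add: label_image[OF S] lbl)
  have "g (rel S x y) = g (id_label S) \<longleftrightarrow> f x = f y"
    if "x \<in> points S" "y \<in> points S" for x y
    using that f g id_label[OF S] rel_in_labels[OF S that]
    by (auto simp: bij_betw_def inj_on_eq_iff)
  then show "\<exists>i\<in>labels T. \<forall>x\<in>points T. \<forall>y\<in>points T. rel T x y = i \<longleftrightarrow> x = y"
    using id_label(1)[OF S] by (intro bexI[of _ "g (id_label S)"]) (auto simp: pts lbl rel)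
  fix c d :: "'j \<Rightarrow> complex"
  obtain h where h: "\<And>x y. x \<in> points S \<Longrightarrow> y \<in> points S \<Longrightarrow>
      (\<Sum>z\<in>points S. c (g (rel S x z)) * d (g (rel S z y))) = h (rel S x y)"
    using convolution_function[OF S, of "c \<circ> g" "d \<circ> g"] by auto
  have "(\<Sum>z\<in>points T. c (rel T (f x) z) * d (rel T z (f y))) = h (rel S x y)"
    if "x \<in> points S" "y \<in> points S" for x y
    using that by (simp add: sum.reindex_bij_betw[OF f, symmetric] rel h cong: sum.cong)
  then show "\<exists>h. \<forall>x\<in>points T. \<forall>y\<in>points T.
      (\<Sum>z\<in>points T. c (rel T x z) * d (rel T z y)) = h (rel T x y)"
    by (intro exI[of _ "h \<circ> inv_into (labels S) g"]) (auto simp: pts rel inv)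
  obtain t where "\<And>x y. x \<in> points S \<Longrightarrow> y \<in> points S \<Longrightarrow> c (g (rel S y x)) = t (rel S x y)"
    using transpose_function[OF S, of "c \<circ> g"] by auto
  then show "\<exists>h. \<forall>x\<in>points T. \<forall>y\<in>points T. c (rel T y x) = h (rel T x y)"
    by (intro exI[of _ "t \<circ> inv_into (labels S) g"]) (auto simp: pts rel inv)
qed

lemma rel_rename:
  assumes "inj_on f (points S)" "x \<in> points S" "y \<in> points S"
  shows "rel (rename f g S) (f x) (f y) = g (rel S x y)"
  using assms by (simp add: rename_def)

lemma assoc_scheme_rename:
  assumes "assoc_scheme S" "inj_on f (points S)" "inj_on g (labels S)"
  shows "assoc_scheme (rename f g S)"
proof (rule assoc_scheme_isomorphic[OF assms(1)])
  show "bij_betw f (points S) (points (rename f g S))"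
    "bij_betw g (labels S) (labels (rename f g S))"
    using assms by (auto simp: rename_def bij_betw_def)
qed (simp add: assms rel_rename)

text \<open>The renaming \<open>\<phi>\<close> is inverted to carry the axioms back from \<open>T\<close>. It is
  injective only on the labels of \<open>S\<close>, so the values of the relation must be known to lie
  there.\<close>

lemma assoc_scheme_same_scheme:
  assumes T: "assoc_scheme T" and same: "same_scheme S T"
    and rel: "\<And>x y. x \<in> points S \<Longrightarrow> y \<in> points S \<Longrightarrow> rel S x y \<in> labels S"
  shows "assoc_scheme S"
proof -
  obtain \<phi> where \<phi>: "bij_betw \<phi> (labels S) (labels T)"
    and eq: "points S = points T"
      "\<And>x y. x \<in> points S \<Longrightarrow> y \<in> points S \<Longrightarrow> rel T x y = \<phi> (rel S x y)"
    using same unfolding same_scheme_def by blast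
  show ?thesis
  proof (rule assoc_scheme_isomorphic[OF T])
    show "bij_betw (\<lambda>x. x) (points T) (points S)"
      using eq by (simp add: bij_betw_def)
    show "bij_betw (inv_into (labels S) \<phi>) (labels T) (labels S)"
      using \<phi> by (rule bij_betw_inv_into)
    show "rel S x y = inv_into (labels S) \<phi> (rel T x y)"
      if "x \<in> points T" "y \<in> points T" for x y
      using that eq rel \<phi> by (simp add: bij_betw_def)
  qed
qed

section \<open>Wreath products of association schemes\<close>

text \<open>Row sums are convolutions with the constant function \<open>1\<close>, evaluated at \<open>(y, y)\<close>;
  their value is thus a function of the identity label alone. Column sums are analogous.\<close>

lemma row_sum_constant:
  fixes f :: "'i \<Rightarrow> complex" and S :: "('a, 'i) scheme"
  assumes "assoc_scheme S"
  obtains r where "\<And>y. y \<in> points S \<Longrightarrow> (\<Sum>z\<in>points S. f (rel S y z)) = r"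
proof -
  obtain h where h: "\<And>x y. x \<in> points S \<Longrightarrow> y \<in> points S \<Longrightarrow>
      (\<Sum>z\<in>points S. f (rel S x z) * 1) = h (rel S x y)"
    using convolution_function[OF assms, of f "\<lambda>_. 1"] by blast
  show thesis
    using that[of "h (id_label S)"] h id_label(2)[OF assms]
    by (metis (no_types, lifting) mult.right_neutral sum.cong)
qed

lemma column_sum_constant:
  fixes f :: "'i \<Rightarrow> complex" and S :: "('a, 'i) scheme"
  assumes "assoc_scheme S"
  obtains r where "\<And>y. y \<in> points S \<Longrightarrow> (\<Sum>z\<in>points S. f (rel S z y)) = r"
proof -
  obtain h where h: "\<And>x y. x \<in> points S \<Longrightarrow> y \<in> points S \<Longrightarrow>
      (\<Sum>z\<in>points S. 1 * f (rel S z y)) = h (rel S x y)"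
    using convolution_function[OF assms, of "\<lambda>_. 1" f] by blast
  show thesis
    using that[of "h (id_label S)"] h id_label(2)[OF assms]
    by (metis (no_types, lifting) mult_1 sum.cong)
qed

lemma points_wreath [simp]: "points (wreath S T) = points S \<times> points T"
  and labels_wreath: "labels (wreath S T) = (labels S - {id_label S}) <+> labels T"
  and rel_wreath: "rel (wreath S T) (x, y) (x', y') =
    (if x \<noteq> x' then Inl (rel S x x') else Inr (rel T y y'))"
  by (simp_all add: wreath_def)

text \<open>The product of two label functions on \<open>X \<times> Y\<close> is computed fibre by fibre. The sum over
  the fibre of a point \<open>a\<close> different from both endpoints does not see the second coordinate,
  whence the factor \<open>|Y|\<close>.\<close>

theorem assoc_scheme_wreath:
  fixes S :: "('a, 'i) scheme" and T :: "('b, 'j) scheme"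
  assumes S: "assoc_scheme S" and T: "assoc_scheme T"
  shows "assoc_scheme (wreath S T)"
proof -
  let ?X = "points S" and ?Y = "points T" and ?W = "wreath S T"
  have finX: "finite ?X" and finY: "finite ?Y"
    using S T by (auto simp: assoc_scheme_def)
  note idS = id_label[OF S] and idT = id_label[OF T]
  have surj: "(\<lambda>(p, q). rel ?W p q) ` (points ?W \<times> points ?W) = labels ?W"
  proof (intro equalityI subsetI)
    fix l assume "l \<in> (\<lambda>(p, q). rel ?W p q) ` (points ?W \<times> points ?W)"
    then show "l \<in> labels ?W"
      using rel_in_labels[OF S] rel_in_labels[OF T] idS(2)
      by (auto simp: labels_wreath rel_wreath)
  next
    fix l assume "l \<in> labels ?W"
    then consider i where "l = Inl i" "i \<in> labels S" "i \<noteq> id_label S"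
      | j where "l = Inr j" "j \<in> labels T"
      by (auto simp: labels_wreath)
    then show "l \<in> (\<lambda>(p, q). rel ?W p q) ` (points ?W \<times> points ?W)"
    proof cases
      case (1 i)
      obtain x x' where x: "x \<in> ?X" "x' \<in> ?X" "i = rel S x x'"
        using 1(2) unfolding label_image[OF S, symmetric] by auto
      moreover obtain y where "y \<in> ?Y" using points_nonempty[OF T] by blast
      ultimately show ?thesis
        using 1 idS(2)[of x x']
        by (intro image_eqI[of _ _ "((x, y), (x', y))"]) (auto simp: rel_wreath)
    next
      case (2 j)
      obtain y y' where "y \<in> ?Y" "y' \<in> ?Y" "j = rel T y y'"
        using 2(2) unfolding label_image[OF T, symmetric] by auto
      moreover obtain x where "x \<in> ?X" using points_nonempty[OF S] by blast
      ultimately show ?thesis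
        using 2 by (intro image_eqI[of _ _ "((x, y), (x, y'))"]) (auto simp: rel_wreath)
    qed
  qed
  have conv: "\<exists>H. \<forall>p\<in>points ?W. \<forall>q\<in>points ?W.
      (\<Sum>r\<in>points ?W. F (rel ?W p r) * G (rel ?W r q)) = H (rel ?W p q)"
    for F G :: "'i + 'j \<Rightarrow> complex"
  proof -
    \<comment> \<open>Annihilating the identity label restricts a convolution in \<open>S\<close> to the fibres
      different from those of the two endpoints.\<close>
    define f where "f i = (if i = id_label S then 0 else F (Inl i))" for i
    define g where "g i = (if i = id_label S then 0 else G (Inl i))" for i
    obtain h where h: "\<And>x x'. x \<in> ?X \<Longrightarrow> x' \<in> ?X \<Longrightarrow>
        (\<Sum>a\<in>?X. f (rel S x a) * g (rel S a x')) = h (rel S x x')"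
      using convolution_function[OF S, of f g] by blast
    obtain k where k: "\<And>y y'. y \<in> ?Y \<Longrightarrow> y' \<in> ?Y \<Longrightarrow>
        (\<Sum>b\<in>?Y. F (Inr (rel T y b)) * G (Inr (rel T b y'))) = k (rel T y y')"
      using convolution_function[OF T, of "F \<circ> Inr" "G \<circ> Inr"] by auto
    obtain r where r: "\<And>y. y \<in> ?Y \<Longrightarrow> (\<Sum>b\<in>?Y. F (Inr (rel T y b))) = r"
      using row_sum_constant[OF T, of "F \<circ> Inr"] by auto
    obtain s where s: "\<And>y. y \<in> ?Y \<Longrightarrow> (\<Sum>b\<in>?Y. G (Inr (rel T b y))) = s"
      using column_sum_constant[OF T, of "G \<circ> Inr"] by auto
    define H where "H = case_sum
      (\<lambda>i. of_nat (card ?Y) * h i + r * G (Inl i) + F (Inl i) * s)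
      (\<lambda>j. of_nat (card ?Y) * h (id_label S) + k j)"
    have "(\<Sum>(a, b)\<in>?X \<times> ?Y. F (rel ?W (x, y) (a, b)) * G (rel ?W (a, b) (x', y'))) =
        H (rel ?W (x, y) (x', y'))"
      if x: "x \<in> ?X" "x' \<in> ?X" and y: "y \<in> ?Y" "y' \<in> ?Y" for x y x' y'
    proof -
      let ?t = "\<lambda>a. \<Sum>b\<in>?Y. F (rel ?W (x, y) (a, b)) * G (rel ?W (a, b) (x', y'))"
      let ?u = "\<lambda>a. of_nat (card ?Y) * (f (rel S x a) * g (rel S a x'))"
      have "(\<Sum>(a, b)\<in>?X \<times> ?Y. F (rel ?W (x, y) (a, b)) * G (rel ?W (a, b) (x', y'))) =
          (\<Sum>a\<in>?X. ?t a)"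
        by (simp add: sum.cartesian_product)
      also have "\<dots> = H (rel ?W (x, y) (x', y'))"
      proof (cases "x = x'")
        case True
        have "?t a = ?u a + (if a = x then k (rel T y y') else 0)" if "a \<in> ?X" for a
          using that x y True by (auto simp: rel_wreath f_def g_def idS(2) k)
        then have "(\<Sum>a\<in>?X. ?t a) =
            of_nat (card ?Y) * (\<Sum>a\<in>?X. f (rel S x a) * g (rel S a x')) + k (rel T y y')"
          using finX x by (simp add: sum.distrib sum_distrib_left cong: sum.cong)
        then show ?thesis
          using True x idS(2)[of x x'] by (simp add: h H_def rel_wreath)
      next
        case False
        have "?t a = ?u a + ((if a = x then r * G (Inl (rel S x x')) else 0)
            + (if a = x' then F (Inl (rel S x x')) * s else 0))" if "a \<in> ?X" for a
          using that x y False
          by (auto simp: rel_wreath f_def g_def idS(2) r s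
              simp flip: sum_distrib_left sum_distrib_right)
        then have "(\<Sum>a\<in>?X. ?t a) =
            of_nat (card ?Y) * (\<Sum>a\<in>?X. f (rel S x a) * g (rel S a x'))
            + (r * G (Inl (rel S x x')) + F (Inl (rel S x x')) * s)"
          using finX x by (simp add: sum.distrib sum_distrib_left cong: sum.cong)
        then show ?thesis
          using False x by (simp add: h H_def rel_wreath)
      qed
      finally show ?thesis .
    qed
    then show ?thesis
      by (intro exI[of _ H]) (auto simp: case_prod_unfold)
  qed
  have trans: "\<exists>H. \<forall>p\<in>points ?W. \<forall>q\<in>points ?W. F (rel ?W q p) = H (rel ?W p q)"
    for F :: "'i + 'j \<Rightarrow> complex"
  proof -
    obtain h where h: "\<And>x x'. x \<in> ?X \<Longrightarrow> x' \<in> ?X \<Longrightarrow> F (Inl (rel S x' x)) = h (rel S x x')"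
      using transpose_function[OF S, of "F \<circ> Inl"] by auto
    obtain k where k: "\<And>y y'. y \<in> ?Y \<Longrightarrow> y' \<in> ?Y \<Longrightarrow> F (Inr (rel T y' y)) = k (rel T y y')"
      using transpose_function[OF T, of "F \<circ> Inr"] by auto
    show ?thesis
      by (rule exI[of _ "case_sum h k"]) (auto simp: rel_wreath h k)
  qed
  show ?thesis
    unfolding assoc_scheme_iff
  proof (intro conjI allI)
    show "finite (points ?W)" using finX finY by simp
    show "finite (labels ?W)" using S T by (auto simp: labels_wreath assoc_scheme_def)
    show "\<exists>i\<in>labels ?W. \<forall>p\<in>points ?W. \<forall>q\<in>points ?W. rel ?W p q = i \<longleftrightarrow> p = q"
      using idT by (intro bexI[of _ "Inr (id_label T)"]) (auto simp: rel_wreath labels_wreath)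
  qed (use surj conv trans in blast)+
qed

lemma assoc_scheme_wreath_power:
  assumes "assoc_scheme S"
  shows "assoc_scheme (wreath_power S (Suc n))"
proof (induction n)
  case 0
  show ?case
    using assms by (auto intro!: assoc_scheme_rename simp: inj_on_def)
next
  case (Suc n)
  have "inj_on (\<lambda>(xs, x). xs @ [x]) A" for A :: "('a list \<times> 'a) set"
    by (auto simp: inj_on_def)
  moreover have "inj_on (case_sum Old New) L" for L :: "('b power_label + 'b) set"
    by (auto simp: inj_on_def split: sum.splits)
  ultimately show ?case
    using Suc assms by (simp add: assoc_scheme_rename assoc_scheme_wreath)
qed

section \<open>Powers of the class-one scheme and kernel schemes\<close>

lemma points_H1 [simp]: "points (H1 V) = V"
  and labels_H1 [simp]: "labels (H1 V) = {I0, I1}"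
  and rel_H1 [simp]: "rel (H1 V) x y = (if x = y then I0 else I1)"
  by (simp_all add: H1_def)

text \<open>Two distinct points are needed for the label \<open>I1\<close> to occur. A convolution sum has
  the same term \<open>f I1 * g I1\<close> at every point except its endpoints, and the corrections
  there depend only on whether the endpoints are equal.\<close>

lemma assoc_scheme_H1:
  assumes "finite V" "card V \<ge> 2"
  shows "assoc_scheme (H1 V)"
proof -
  obtain a b where ab: "a \<in> V" "b \<in> V" "a \<noteq> b"
    using assms by (metis card_le_Suc0_iff_eq not_less_eq_eq numeral_2_eq_2)
  have surj: "(\<lambda>(x, y). rel (H1 V) x y) ` (points (H1 V) \<times> points (H1 V)) = labels (H1 V)"
    using ab by (fastforce simp: image_iff)
  have conv: "\<exists>h. \<forall>x\<in>V. \<forall>y\<in>V.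
      (\<Sum>z\<in>V. f (if x = z then I0 else I1) * g (if z = y then I0 else I1)) =
        h (if x = y then I0 else I1)" for f g :: "h_label \<Rightarrow> complex"
  proof -
    let ?c = "of_nat (card V) * (f I1 * g I1)"
    have "(\<Sum>z\<in>V. f (if x = z then I0 else I1) * g (if z = y then I0 else I1)) =
        (if x = y then ?c + (f I0 * g I0 - f I1 * g I1)
         else ?c + (f I0 * g I1 - f I1 * g I1) + (f I1 * g I0 - f I1 * g I1))"
      if "x \<in> V" "y \<in> V" for x y
    proof -
      have "(\<Sum>z\<in>V. f (if x = z then I0 else I1) * g (if z = y then I0 else I1)) =
          (\<Sum>z\<in>V. f I1 * g I1
            + (if z = x then (if x = y then f I0 * g I0 else f I0 * g I1) - f I1 * g I1 else 0)
            + (if z = y then (if x = y then 0 else f I1 * g I0 - f I1 * g I1) else 0))"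
        by (intro sum.cong) auto
      also have "\<dots> = ?c
          + ((if x = y then f I0 * g I0 else f I0 * g I1) - f I1 * g I1)
          + (if x = y then 0 else f I1 * g I0 - f I1 * g I1)"
        using assms that by (simp add: sum.distrib)
      finally show ?thesis by simp
    qed
    then show ?thesis
      by (intro exI[of _ "\<lambda>l. if l = I0 then ?c + (f I0 * g I0 - f I1 * g I1)
         else ?c + (f I0 * g I1 - f I1 * g I1) + (f I1 * g I0 - f I1 * g I1)"]) auto
  qed
  show ?thesis
    unfolding assoc_scheme_iff
  proof (intro conjI allI surj)
    show "\<exists>h. \<forall>x\<in>points (H1 V). \<forall>y\<in>points (H1 V). f (rel (H1 V) y x) = h (rel (H1 V) x y)"
      for f :: "h_label \<Rightarrow> complex"
      by (rule exI[of _ f]) auto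
  qed (use assms conv in auto)
qed

lemma points_kernel_scheme [simp]: "points (kernel_scheme n V) = {xs. length xs = n \<and> set xs \<subseteq> V}"
  and labels_kernel_scheme: "labels (kernel_scheme n V) = enat ` {1..n} \<union> {\<infinity>}"
  by (simp_all add: kernel_scheme_def)

lemma rel_kernel_scheme_self [simp]: "rel (kernel_scheme n V) xs xs = \<infinity>"
  by (simp add: kernel_scheme_def)

lemma rel_kernel_scheme_eqI:
  assumes "1 \<le> k" "k \<le> n" "xs ! (k - 1) \<noteq> ys ! (k - 1)"
    and "\<And>i. 1 \<le> i \<Longrightarrow> i \<le> n \<Longrightarrow> xs ! (i - 1) \<noteq> ys ! (i - 1) \<Longrightarrow> k \<le> i"
  shows "rel (kernel_scheme n V) xs ys = enat k"
proof -
  have "(LEAST i. 1 \<le> i \<and> i \<le> n \<and> xs ! (i - 1) \<noteq> ys ! (i - 1)) = k"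
    using assms by (intro Least_equality) auto
  then show ?thesis using assms(3) by (auto simp: kernel_scheme_def)
qed

lemma rel_kernel_scheme_distinct:
  assumes "length xs = n" "length ys = n" "xs \<noteq> ys"
  obtains k where "rel (kernel_scheme n V) xs ys = enat k" "1 \<le> k" "k \<le> n"
    "xs ! (k - 1) \<noteq> ys ! (k - 1)"
    "\<And>i. 1 \<le> i \<Longrightarrow> i \<le> n \<Longrightarrow> xs ! (i - 1) \<noteq> ys ! (i - 1) \<Longrightarrow> k \<le> i"
proof -
  let ?P = "\<lambda>i. 1 \<le> i \<and> i \<le> n \<and> xs ! (i - 1) \<noteq> ys ! (i - 1)"
  obtain j where "j < n" "xs ! j \<noteq> ys ! j"
    using assms by (auto simp: list_eq_iff_nth_eq)
  then have "?P (Suc j)" by simp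
  then have P: "?P (LEAST i. ?P i)" by (rule LeastI)
  show thesis
  proof (rule that)
    show "rel (kernel_scheme n V) xs ys = enat (LEAST i. ?P i)"
      using assms(3) by (simp add: kernel_scheme_def)
    show "(LEAST i. ?P i) \<le> i" if "1 \<le> i" "i \<le> n" "xs ! (i - 1) \<noteq> ys ! (i - 1)" for i
      using that by (intro Least_le conjI)
  qed (use P in blast)+
qed

lemma rel_kernel_scheme_in_labels:
  assumes "xs \<in> points (kernel_scheme n V)" "ys \<in> points (kernel_scheme n V)"
  shows "rel (kernel_scheme n V) xs ys \<in> labels (kernel_scheme n V)"
proof (cases "xs = ys")
  case False
  with assms obtain k where "rel (kernel_scheme n V) xs ys = enat k" "1 \<le> k" "k \<le> n"
    by (metis (mono_tags, lifting) mem_Collect_eq points_kernel_scheme rel_kernel_scheme_distinct)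
  then show ?thesis by (simp add: labels_kernel_scheme)
qed (simp add: labels_kernel_scheme)

text \<open>The first difference of two words is found in the proper prefixes if these differ; this is
  the wreath product recursion for \<^const>\<open>kernel_scheme\<close>.\<close>

lemma kernel_scheme_snoc:
  assumes "length xs = n" "length ys = n"
  shows "rel (kernel_scheme (Suc n) V) (xs @ [x]) (ys @ [y]) =
    (if xs \<noteq> ys then rel (kernel_scheme n V) xs ys
     else if x \<noteq> y then enat (Suc n) else \<infinity>)"
proof (cases "xs = ys")
  case True
  show ?thesis
  proof (cases "x = y")
    case False
    then have "rel (kernel_scheme (Suc n) V) (xs @ [x]) (ys @ [y]) = enat (Suc n)"
      using assms True
      by (intro rel_kernel_scheme_eqI) (auto simp: nth_append split: if_splits)
    then show ?thesis using True False by simp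
  qed (simp add: True)
next
  case False
  then obtain k where k: "rel (kernel_scheme n V) xs ys = enat k" "1 \<le> k" "k \<le> n"
    "xs ! (k - 1) \<noteq> ys ! (k - 1)"
    "\<And>i. 1 \<le> i \<Longrightarrow> i \<le> n \<Longrightarrow> xs ! (i - 1) \<noteq> ys ! (i - 1) \<Longrightarrow> k \<le> i"
    using rel_kernel_scheme_distinct[OF assms] by metis
  have "rel (kernel_scheme (Suc n) V) (xs @ [x]) (ys @ [y]) = enat k"
  proof (rule rel_kernel_scheme_eqI)
    show "k \<le> i" if "1 \<le> i" "i \<le> Suc n"
      "(xs @ [x]) ! (i - 1) \<noteq> (ys @ [y]) ! (i - 1)" for i
    proof (cases "i \<le> n")
      case True
      then have "i - 1 < n" using that(1) by linarith
      then show ?thesis using that k(5)[OF that(1) True] assms by (simp add: nth_append)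
    qed (use k(3) in simp)
  qed (use k assms in \<open>auto simp: nth_append\<close>)
  then show ?thesis using False k(1) by simp
qed

text \<open>The dictionary between the labels. A difference at position \<open>i\<close> enters at the
  \<open>i\<close>th step as \<open>New I1\<close> and passes through the \<open>n - i\<close> remaining ones.\<close>

definition first_difference_label :: "nat \<Rightarrow> enat \<Rightarrow> h_label power_label" where
  "first_difference_label n l =
    (case l of enat i \<Rightarrow> (Old ^^ (n - i)) (New I1) | \<infinity> \<Rightarrow> New I0)"

lemma first_difference_label_simps:
  "first_difference_label n \<infinity> = New I0"
  "first_difference_label n (enat n) = New I1"
  "i \<le> n \<Longrightarrow> first_difference_label (Suc n) (enat i) = Old (first_difference_label n (enat i))"
  by (simp_all add: first_difference_label_def Suc_diff_le)

lemma Old_power_New_eq_iff: "(Old ^^ a) (New i) = (Old ^^ b) (New j) \<longleftrightarrow> a = b \<and> i = j"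
proof (induction a arbitrary: b)
  case 0
  show ?case by (cases b) auto
next
  case (Suc a)
  then show ?case by (cases b) auto
qed

lemma Old_power_New_I1_neq: "(Old ^^ a) (New I1) \<noteq> New I0"
  by (cases a) auto

lemma inj_on_first_difference_label:
  "inj_on (first_difference_label n) (labels (kernel_scheme n V))"
proof (rule inj_onI)
  fix k l
  assume "k \<in> labels (kernel_scheme n V)" "l \<in> labels (kernel_scheme n V)"
    "first_difference_label n k = first_difference_label n l"
  then show "k = l"
    using Old_power_New_I1_neq Old_power_New_I1_neq[symmetric]
    by (auto simp: first_difference_label_def labels_kernel_scheme Old_power_New_eq_iff)
qed

text \<open>The three claims are proved by one induction: the identity label of the shorter power,
  which the wreath product removes, is read off from its relation, and the remaining labels are
  then those on which \<open>Old\<close> acts.\<close>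

lemma wreath_power_H1:
  assumes "finite V" "card V \<ge> 2"
  shows "points (wreath_power (H1 V) (Suc n)) = points (kernel_scheme (Suc n) V)" (is "?points n")
    and "labels (wreath_power (H1 V) (Suc n)) =
      first_difference_label (Suc n) ` labels (kernel_scheme (Suc n) V)" (is "?labels n")
    and "xs \<in> points (kernel_scheme (Suc n) V) \<Longrightarrow> ys \<in> points (kernel_scheme (Suc n) V) \<Longrightarrow>
      rel (wreath_power (H1 V) (Suc n)) xs ys =
      first_difference_label (Suc n) (rel (kernel_scheme (Suc n) V) xs ys)"
proof -
  let ?K = "\<lambda>n. kernel_scheme n V" and ?P = "\<lambda>n. wreath_power (H1 V) (Suc n)"
  let ?rel = "\<lambda>n. \<forall>xs\<in>points (?K (Suc n)). \<forall>ys\<in>points (?K (Suc n)).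
    rel (?P n) xs ys = first_difference_label (Suc n) (rel (?K (Suc n)) xs ys)"
  have "?points n \<and> ?labels n \<and> ?rel n"
  proof (induction n)
    case 0
    have "?points 0"
      by (auto simp: rename_def length_Suc_conv)
    moreover have "?labels 0"
      by (auto simp: rename_def labels_kernel_scheme first_difference_label_def)
    moreover have "?rel 0"
    proof (intro ballI)
      fix xs ys assume "xs \<in> points (?K (Suc 0))" "ys \<in> points (?K (Suc 0))"
      then obtain x y where xy: "xs = [x]" "ys = [y]" "x \<in> V" "y \<in> V"
        by (auto simp: length_Suc_conv)
      have "rel (?P 0) xs ys = New (rel (H1 V) x y)"
        using xy rel_rename[of "\<lambda>x. [x]" "H1 V" x y New] by (simp add: inj_on_def)
      then show "rel (?P 0) xs ys = first_difference_label (Suc 0) (rel (?K (Suc 0)) xs ys)"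
        using kernel_scheme_snoc[of "[]" 0 "[]" V x y]
        by (simp add: xy first_difference_label_simps)
    qed
    ultimately show ?case by blast
  next
    case (Suc n)
    let ?f = "\<lambda>(xs, x). xs @ [x]" and ?g = "case_sum Old New"
    let ?W = "wreath (?P n) (H1 V)"
    have P: "?P (Suc n) = rename ?f ?g ?W" by simp
    have pts: "points (?P n) = points (?K (Suc n))" using Suc by blast
    have assoc: "assoc_scheme (?P n)"
      using assms by (intro assoc_scheme_wreath_power assoc_scheme_H1)
    obtain p where p: "p \<in> points (?P n)" using points_nonempty[OF assoc] by blast
    have id: "id_label (?P n) = New I0"
    proof -
      have "rel (?P n) p p = New I0"
        using Suc p pts by (simp add: first_difference_label_simps del: wreath_power.simps)
      then show ?thesis using id_label(2)[OF assoc p p] by simp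
    qed
    have points_snoc: "points (?K (Suc (Suc n))) = ?f ` (points (?K (Suc n)) \<times> V)"
    proof (intro equalityI subsetI)
      fix zs assume "zs \<in> points (?K (Suc (Suc n)))"
      then show "zs \<in> ?f ` (points (?K (Suc n)) \<times> V)"
        by (cases zs rule: rev_cases) (auto simp: image_iff)
    qed auto
    have "?points (Suc n)"
      unfolding points_snoc unfolding P rename_def by (simp add: pts del: wreath_power.simps)
    moreover have "?labels (Suc n)"
    proof -
      have "labels (?K (Suc n)) = insert \<infinity> (enat ` {1..Suc n})"
        and K: "labels (?K (Suc (Suc n))) = {\<infinity>, enat (Suc (Suc n))} \<union> enat ` {1..Suc n}"
        by (auto simp: labels_kernel_scheme atLeastAtMostSuc_conv)
      then have "labels (?P n) =
          insert (New I0) (first_difference_label (Suc n) ` enat ` {1..Suc n})"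
        using Suc by (simp add: first_difference_label_simps del: wreath_power.simps)
      moreover have "New I0 \<notin> first_difference_label (Suc n) ` enat ` {1..Suc n}"
        using Old_power_New_I1_neq[symmetric] by (auto simp: first_difference_label_def)
      ultimately have "labels (?P n) - {id_label (?P n)} =
          first_difference_label (Suc n) ` enat ` {1..Suc n}"
        by (simp add: id del: wreath_power.simps)
      then have "labels (?P (Suc n)) =
          Old ` first_difference_label (Suc n) ` enat ` {1..Suc n} \<union> {New I0, New I1}"
        unfolding P rename_def
        by (simp add: labels_wreath Plus_def image_Un image_image del: wreath_power.simps)
      also have "Old ` first_difference_label (Suc n) ` enat ` {1..Suc n} =
          first_difference_label (Suc (Suc n)) ` enat ` {1..Suc n}"
        unfolding image_image
        by (intro image_cong) (auto simp: first_difference_label_simps)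
      finally show ?thesis
        unfolding K by (auto simp: first_difference_label_simps)
    qed
    moreover have "?rel (Suc n)"
    proof (intro ballI)
      fix zs ws assume "zs \<in> points (?K (Suc (Suc n)))" "ws \<in> points (?K (Suc (Suc n)))"
      then obtain xs x ys y where z: "zs = xs @ [x]" "ws = ys @ [y]"
        and xs: "xs \<in> points (?K (Suc n))" "ys \<in> points (?K (Suc n))" and x: "x \<in> V" "y \<in> V"
        unfolding points_snoc by (auto simp del: points_kernel_scheme)
      have "inj_on ?f (points ?W)" by (auto simp: inj_on_def)
      then have "rel (?P (Suc n)) zs ws = ?g (rel ?W (xs, x) (ys, y))"
        unfolding P z using rel_rename[of ?f ?W "(xs, x)" "(ys, y)" ?g] xs x pts
        by (simp del: wreath_power.simps points_kernel_scheme)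
      also have "\<dots> = (if xs \<noteq> ys
          then Old (first_difference_label (Suc n) (rel (?K (Suc n)) xs ys))
          else New (if x = y then I0 else I1))"
        using Suc xs by (simp add: rel_wreath del: wreath_power.simps)
      also have "\<dots> = first_difference_label (Suc (Suc n)) (rel (?K (Suc (Suc n))) zs ws)"
      proof (cases "xs = ys")
        case True
        then show ?thesis
          using xs by (simp add: z kernel_scheme_snoc first_difference_label_simps)
      next
        case False
        then obtain k where "rel (?K (Suc n)) xs ys = enat k" "k \<le> Suc n"
          using xs by (metis (mono_tags, lifting) mem_Collect_eq points_kernel_scheme
              rel_kernel_scheme_distinct)
        then show ?thesis
          using xs False by (simp add: z kernel_scheme_snoc first_difference_label_simps)
      qed
      finally show "rel (?P (Suc n)) zs ws =
          first_difference_label (Suc (Suc n)) (rel (?K (Suc (Suc n))) zs ws)" .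
    qed
    ultimately show ?case by blast
  qed
  then show "?points n" "?labels n"
    and "xs \<in> points (?K (Suc n)) \<Longrightarrow> ys \<in> points (?K (Suc n)) \<Longrightarrow>
      rel (?P n) xs ys = first_difference_label (Suc n) (rel (?K (Suc n)) xs ys)"
    by blast+
qed

theorem proposition4p4:
  fixes V :: "'v set" and n v :: nat
  assumes "n \<ge> 1" and "v \<ge> 2" and "finite V" and "card V = v"
  shows "assoc_scheme (kernel_scheme n V)
       \<and> assoc_scheme (wreath_power (H1 V) n)
       \<and> same_scheme (kernel_scheme n V) (wreath_power (H1 V) n)"
proof -
  obtain m where n: "n = Suc m" using assms(1) by (cases n) auto
  have V: "finite V" "card V \<ge> 2" using assms by auto
  have power: "assoc_scheme (wreath_power (H1 V) n)"
    unfolding n using V by (intro assoc_scheme_wreath_power assoc_scheme_H1)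
  have same: "same_scheme (kernel_scheme n V) (wreath_power (H1 V) n)"
    unfolding same_scheme_def
  proof (intro conjI exI[of _ "first_difference_label n"] ballI)
    show "bij_betw (first_difference_label n) (labels (kernel_scheme n V))
        (labels (wreath_power (H1 V) n))"
      unfolding bij_betw_def n
      using inj_on_first_difference_label wreath_power_H1(2)[OF V] by metis
  qed (use wreath_power_H1[OF V] n in metis)+
  have "assoc_scheme (kernel_scheme n V)"
    using power same rel_kernel_scheme_in_labels by (rule assoc_scheme_same_scheme)
  with power same show ?thesis by blast
qed

end
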